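(* Let $X$ be a Banach space. Then $$K_{1}(X)\leqslant G(X)\leqslant R(X^{*}).$$
   Context: Banach spaces are infinite-dimensional, over the real or complex field; $B_X$ denotes the closed unit ball of $X$, and $\mathcal F_X$ the family of all weakly compact subsets of $B_X$. A sequence $(y_n)_{n=1}^\infty$ is a convex block subsequence of $(x_n)_{n=1}^\infty$ if there is a strictly increasing sequence of positive integers $(k_n)_{n=1}^\infty$ such that, with $k_0=0$, $y_n\in\operatorname{conv}\{x_i: k_{n-1}+1\leqslant i\leqslant k_n\}$ for every $n\in\mathbb N$. The collection of all convex block subsequences of $(x_n)$ is denoted $\operatorname{cbs}((x_n)_{n=1}^\infty)$. For a bounded sequence $(f_n)_{n=1}^\infty$ in $X^*$ define $$\alpha((f_n)_{n=1}^\infty)=\sup_{K\in\mathcal F_X}\limsup_{n\to\infty}\sup_{x\in K}|\langle f_n,x\rangle|.$$ Define $$K_1(X)=\sup_{(f_n)}\ \inf_{(g_n)\in\operatorname{cbs}((f_n))}\alpha((g_n)_{n=1}^\infty),\qquad G(X)=\sup_{(f_n)}\ \inf_{(g_n)\in\operatorname{cbs}((f_n))}\limsup_{n\to\infty}\|g_n\|,$$ where both suprema are over all weak$^*$ null sequences $(f_n)_{n=1}^\infty$ in $B_{X^*}$. For a bounded sequence $(x_n)_{n=1}^\infty$ in a Banach space set $\operatorname{ca}((x_n)_{n=1}^\infty)=\inf_{n\in\mathbb N}\sup_{k,l\geqslant n}\|x_k-x_l\|$. For a Banach space $Y$ define $$R(Y)=\sup_{(x_n)_{n=1}^\infty\subseteq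 B_Y}\ \inf_{(z_n)\in\operatorname{cbs}((x_n))}\operatorname{ca}((z_n)_{n=1}^\infty),$$ where the supremum is over all sequences in $B_Y$. *)

theory Defs
  imports "HOL-Analysis.Analysis"
begin

text \<open>
  The library only provides real normed spaces as a type class.  A Banach space over the field
  \<open>'k\<close> (which will be \<open>real\<close> or \<open>complex\<close>) is a type of class \<open>banach\<close> together with a scalar
  multiplication by \<open>'k\<close> that extends the given real one and is compatible with the norm.
  For \<open>'k = real\<close> the only such multiplication is \<^const>\<open>scaleR\<close>.
\<close>

locale normed_space_over = vector_space sc
  for sc :: "'k::real_normed_field \<Rightarrow> 'a::real_normed_vector \<Rightarrow> 'a" +
  assumes sc_of_real: "sc (of_real r) x = r *\<^sub>R x"
    and norm_sc: "norm (sc c x) = norm c * norm x"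

definition infinite_dimensional ::
    "('k::real_normed_field \<Rightarrow> 'a::real_normed_vector \<Rightarrow> 'a) \<Rightarrow> bool" where
  "infinite_dimensional sc \<longleftrightarrow> (\<forall>B. finite B \<longrightarrow> module.span sc B \<noteq> UNIV)"

text \<open>
  The dual space: the \<open>'k\<close>-linear elements of the space of bounded real-linear maps into \<open>'k\<close>,
  with the operator norm of \<^typ>\<open>'a \<Rightarrow>\<^sub>L 'k\<close>.
\<close>

definition dual_space ::
    "('k::real_normed_field \<Rightarrow> 'a::real_normed_vector \<Rightarrow> 'a) \<Rightarrow> ('a \<Rightarrow>\<^sub>L 'k) set" where
  "dual_space sc =
     {f. \<forall>c x. blinfun_apply f (sc c x) = c * blinfun_apply f x}"

definition weak_topology ::
    "('k::real_normed_field \<Rightarrow> 'a::real_normed_vector \<Rightarrow> 'a) \<Rightarrow> 'a topology" where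
  "weak_topology sc =
     topology_generated_by {blinfun_apply f -` U | f U. f \<in> dual_space sc \<and> open U}"

definition weakly_compact_subsets_of_ball ::
    "('k::real_normed_field \<Rightarrow> 'a::real_normed_vector \<Rightarrow> 'a) \<Rightarrow> 'a set set" where
  "weakly_compact_subsets_of_ball sc =
     {K. K \<subseteq> cball 0 1 \<and> compactin (weak_topology sc) K}"

definition weakstar_null_sequences_in_ball ::
    "('k::real_normed_field \<Rightarrow> 'a::real_normed_vector \<Rightarrow> 'a) \<Rightarrow> (nat \<Rightarrow> 'a \<Rightarrow>\<^sub>L 'k) set" where
  "weakstar_null_sequences_in_ball sc =
     {f. (\<forall>n. f n \<in> dual_space sc \<inter> cball 0 1) \<and>
         (\<forall>x. (\<lambda>n. blinfun_apply (f n) x) \<longlonglongrightarrow> 0)}"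

text \<open>
  Sequences are indexed from \<open>0\<close>: the \<open>n\<close>-th term here is the \<open>(n+1)\<close>-st term of a sequence
  indexed by the positive integers, so the block \<open>k\<^sub>n + 1 \<le> i \<le> k\<^sub>n\<^sub>+\<^sub>1\<close> becomes
  \<open>k n \<le> i < k (Suc n)\<close>.
\<close>

definition cbs :: "(nat \<Rightarrow> 'b::real_vector) \<Rightarrow> (nat \<Rightarrow> 'b) set" where
  "cbs x = {y. \<exists>k::nat \<Rightarrow> nat. strict_mono k \<and> k 0 = 0 \<and>
                 (\<forall>n. y n \<in> convex hull (x ` {k n..<k (Suc n)}))}"

text \<open>
  All suprema and infima below are of nonnegative quantities and are taken in \<^typ>\<open>ennreal\<close>; in
  particular the supremum over the empty weakly compact set is \<open>0\<close>.
\<close>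

definition alpha_seq ::
    "('k::real_normed_field \<Rightarrow> 'a::real_normed_vector \<Rightarrow> 'a) \<Rightarrow> (nat \<Rightarrow> 'a \<Rightarrow>\<^sub>L 'k) \<Rightarrow> ennreal" where
  "alpha_seq sc f =
     (SUP K \<in> weakly_compact_subsets_of_ball sc.
        limsup (\<lambda>n. SUP x \<in> K. ennreal (norm (blinfun_apply (f n) x))))"

definition K1_const ::
    "('k::real_normed_field \<Rightarrow> 'a::real_normed_vector \<Rightarrow> 'a) \<Rightarrow> ennreal" where
  "K1_const sc =
     (SUP f \<in> weakstar_null_sequences_in_ball sc. INF g \<in> cbs f. alpha_seq sc g)"

definition G_const ::
    "('k::real_normed_field \<Rightarrow> 'a::real_normed_vector \<Rightarrow> 'a) \<Rightarrow> ennreal" where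
  "G_const sc =
     (SUP f \<in> weakstar_null_sequences_in_ball sc. INF g \<in> cbs f.
        limsup (\<lambda>n. ennreal (norm (g n))))"

definition ca :: "(nat \<Rightarrow> 'b::real_normed_vector) \<Rightarrow> ennreal" where
  "ca x = (INF n. SUP k \<in> {n..}. SUP l \<in> {n..}. ennreal (norm (x k - x l)))"

text \<open>The space \<open>Y\<close> is given as a closed linear subspace of an ambient normed space.\<close>

definition R_const :: "'b::real_normed_vector set \<Rightarrow> ennreal" where
  "R_const Y = (SUP x \<in> {x. \<forall>n. x n \<in> Y \<inter> cball 0 1}. INF z \<in> cbs x. ca z)"

lemma normed_space_over_scaleR:
  "normed_space_over (scaleR :: real \<Rightarrow> 'a::real_normed_vector \<Rightarrow> 'a)"
  by unfold_locales (auto simp: algebra_simps)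

lemma dual_space_scaleR:
  "dual_space (scaleR :: real \<Rightarrow> 'a::real_normed_vector \<Rightarrow> 'a) = UNIV"
  by (auto simp: dual_space_def blinfun.scaleR_right)

lemma subspace_dual_space: "subspace (dual_space sc)"
  by (auto simp: dual_space_def subspace_def blinfun.add_left blinfun.scaleR_left
      blinfun.zero_left distrib_left)

lemma closed_dual_space: "closed (dual_space sc)"
  unfolding dual_space_def
  by (intro closed_Collect_all closed_Collect_eq continuous_intros)

end

theory Submission
  imports Defs
begin

text \<open>
  On the unit ball \<open>\<bar>\<langle>f, x\<rangle>\<bar> \<le> \<parallel>f\<parallel>\<close>, which gives the first inequality.  For the second, a convex block
  subsequence \<open>(z\<^sub>n)\<close> of a weak* null sequence is again weak* null, so letting \<open>l\<close> tend to infinity in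
  \<open>\<bar>\<langle>z\<^sub>k - z\<^sub>l, x\<rangle>\<bar> \<le> \<parallel>z\<^sub>k - z\<^sub>l\<parallel> \<parallel>x\<parallel>\<close> bounds \<open>\<parallel>z\<^sub>k\<parallel>\<close> by the oscillation of \<open>(z\<^sub>n)\<close> beyond \<open>k\<close>.
\<close>

lemma alpha_seq_le_limsup_norm:
  "alpha_seq sc g \<le> limsup (\<lambda>n. ennreal (norm (g n)))"
  unfolding alpha_seq_def
proof (intro SUP_least Limsup_mono always_eventually allI ennreal_leI)
  fix K n x
  assume "K \<in> weakly_compact_subsets_of_ball sc" "x \<in> K"
  then have "norm x \<le> 1"
    by (auto simp: weakly_compact_subsets_of_ball_def)
  then show "norm (blinfun_apply (g n) x) \<le> norm (g n)"
    using norm_blinfun[of "g n" x] mult_left_mono[of "norm x" 1 "norm (g n)"] by simp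
qed

lemma K1_const_le_G_const: "K1_const sc \<le> G_const sc"
  unfolding K1_const_def G_const_def
  by (rule SUP_mono', rule INF_mono', rule alpha_seq_le_limsup_norm)

text \<open>For fixed \<open>x\<close> and \<open>e\<close>, the operators \<open>h\<close> with
  \<open>norm (h x) < e\<close> form a convex set, so once it contains a block of \<open>f\<close>
  it contains the convex hull of that block.\<close>

lemma cbs_pointwise_null:
  fixes f :: "nat \<Rightarrow> 'a::real_normed_vector \<Rightarrow>\<^sub>L 'b::real_normed_vector"
  assumes f: "(\<lambda>n. blinfun_apply (f n) x) \<longlonglongrightarrow> 0"
    and z: "z \<in> cbs f"
  shows "(\<lambda>n. blinfun_apply (z n) x) \<longlonglongrightarrow> 0"
proof (rule LIMSEQ_I)
  fix e :: real
  assume "e > 0"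
  then obtain N where N: "\<And>n. n \<ge> N \<Longrightarrow> norm (blinfun_apply (f n) x) < e"
    using LIMSEQ_D[OF f] by auto
  obtain k where k: "strict_mono k" "\<And>n. z n \<in> convex hull (f ` {k n..<k (Suc n)})"
    using z by (auto simp: cbs_def)
  let ?C = "(\<lambda>h :: 'a \<Rightarrow>\<^sub>L 'b. blinfun_apply h x) -` ball 0 e"
  have "linear (\<lambda>h :: 'a \<Rightarrow>\<^sub>L 'b. blinfun_apply h x)"
    by (rule linearI) (simp_all add: blinfun.add_left blinfun.scaleR_left)
  then have "convex ?C"
    by (rule convex_linear_vimage) simp
  \<comment> \<open>Strict monotonicity gives \<open>n \<le> k n\<close>, so the threshold
    \<open>N\<close> found for \<open>f\<close> also serves for \<open>z\<close>.\<close>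
  moreover have "f ` {k n..<k (Suc n)} \<subseteq> ?C" if "n \<ge> N" for n
    using N order_trans[OF that] order_trans[OF seq_suble[OF k(1), of n]] by auto
  ultimately have "convex hull (f ` {k n..<k (Suc n)}) \<subseteq> ?C" if "n \<ge> N" for n
    using that by (intro hull_minimal)
  then have "z n \<in> ?C" if "n \<ge> N" for n
    using k(2)[of n] that by (metis subsetD)
  then show "\<exists>N. \<forall>n\<ge>N. norm (blinfun_apply (z n) x - 0) < e"
    by (auto simp: dist_norm)
qed

lemma pointwise_null_limsup_norm_le_ca:
  fixes z :: "nat \<Rightarrow> 'a::real_normed_vector \<Rightarrow>\<^sub>L 'b::real_normed_vector"
  assumes z: "\<And>x. (\<lambda>n. blinfun_apply (z n) x) \<longlonglongrightarrow> 0"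
  shows "limsup (\<lambda>n. ennreal (norm (z n))) \<le> ca z"
  unfolding ca_def
proof (rule INF_greatest)
  fix n
  let ?M = "SUP k\<in>{n..}. SUP l\<in>{n..}. ennreal (norm (z k - z l))"
  have "ennreal (norm (z k)) \<le> ?M" if "k \<ge> n" for k
  \<comment> \<open>An infinite \<open>?M\<close> bounds everything; a finite one is a real
    \<open>m\<close>, which can serve as an operator norm bound for \<open>z k\<close>.\<close>
  proof (cases ?M)
    case (real m)
    have m: "norm (z k - z l) \<le> m" if "l \<ge> n" for l
    proof -
      have "ennreal (norm (z k - z l)) \<le> ?M"
        using \<open>k \<ge> n\<close> that by (intro SUP_upper2[of k] SUP_upper2[of l]) auto
      then show ?thesis
        using real by simp
    qed
    have "norm (blinfun_apply (z k) x) \<le> m * norm x" for x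
    proof (rule tendsto_upperbound)
      show "(\<lambda>l. norm (blinfun_apply (z k - z l) x)) \<longlonglongrightarrow> norm (blinfun_apply (z k) x)"
        using tendsto_norm[OF tendsto_diff[OF tendsto_const z]] by (simp add: blinfun.diff_left)
      show "\<forall>\<^sub>F l in sequentially. norm (blinfun_apply (z k - z l) x) \<le> m * norm x"
        using eventually_ge_at_top[of n]
      proof eventually_elim
        case (elim l)
        show ?case
          using norm_blinfun[of "z k - z l" x] mult_right_mono[OF m[OF elim], of "norm x"] by simp
      qed
    qed simp
    then show ?thesis
      using real by (simp add: norm_blinfun_bound)
  qed (simp only: top_greatest)
  then show "limsup (\<lambda>n. ennreal (norm (z n))) \<le> ?M"
    by (intro Limsup_bounded) (auto simp: eventually_sequentially)
qed

lemma G_const_le_R_const: "G_const sc \<le> R_const (dual_space sc)"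
  unfolding G_const_def R_const_def
proof (rule SUP_mono)
  fix f
  assume f: "f \<in> weakstar_null_sequences_in_ball sc"
  have "limsup (\<lambda>n. ennreal (norm (z n))) \<le> ca z" if "z \<in> cbs f" for z
    using f
    by (intro pointwise_null_limsup_norm_le_ca cbs_pointwise_null[OF _ that])
      (auto simp: weakstar_null_sequences_in_ball_def)
  then have "(INF z\<in>cbs f. limsup (\<lambda>n. ennreal (norm (z n)))) \<le> (INF z\<in>cbs f. ca z)"
    by (intro INF_superset_mono) auto
  \<comment> \<open>The witness is \<open>f\<close> itself: it lies in the dual unit ball, so it is
    one of the sequences over which \<open>R_const\<close> takes its supremum.\<close>
  then show "\<exists>x\<in>{x. \<forall>n. x n \<in> dual_space sc \<inter> cball 0 1}.
      (INF z\<in>cbs f. limsup (\<lambda>n. ennreal (norm (z n)))) \<le> (INF z\<in>cbs x. ca z)"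
    using f by (intro bexI[of _ f]) (auto simp: weakstar_null_sequences_in_ball_def)
qed

theorem theorem4p11:
  shows
    "(\<forall>sc :: real \<Rightarrow> 'a::banach \<Rightarrow> 'a.
        normed_space_over sc \<longrightarrow> infinite_dimensional sc \<longrightarrow>
          K1_const sc \<le> G_const sc \<and>
          G_const sc \<le> R_const (dual_space sc)) \<and>
     (\<forall>sc :: complex \<Rightarrow> 'a::banach \<Rightarrow> 'a.
        normed_space_over sc \<longrightarrow> infinite_dimensional sc \<longrightarrow>
          K1_const sc \<le> G_const sc \<and>
          G_const sc \<le> R_const (dual_space sc))"
  \<comment> \<open>Both lemmas are polymorphic in the scalar field, so they cover the real and the
    complex case alike.\<close>
  by (simp add: K1_const_le_G_const G_const_le_R_const)

end
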